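(* Let $\mathbb{K}$ be a Hausdorff topological field (possibly non-discrete), and let $X$ be any set. Endow $\mathbb{K}^X$ with the product topology. Then the topological dual $(\mathbb{K}^X)^{\prime}$ of $\mathbb{K}^X$ is isomorphic, as a $\mathbb{K}$-vector space, to $\mathbb{K}^{(X)}$.
   Context: A topological field is a (commutative) field $\mathbb{K}$ with a topology for which $x\mapsto -x$, $(x,y)\mapsto x+y$, $(x,y)\mapsto xy$ are continuous (with the product topology on $\mathbb{K}\times\mathbb{K}$) and $x\mapsto x^{-1}$ is continuous on $\mathbb{K}\setminus\{0\}$ with the subspace topology. $\mathbb{K}^X$ is the $\mathbb{K}$-vector space of all maps $X\to\mathbb{K}$; the product topology on it is the coarsest topology making all the projections $\pi_x\colon f\mapsto f(x)$, $x\in X$, continuous. $\mathbb{K}^{(X)}$ is the $\mathbb{K}$-vector space of all finitely supported maps $X\to\mathbb{K}$. The topological dual $V^{\prime}$ of a topological $\mathbb{K}$-vector space $V$ is the $\mathbb{K}$-vector space of all continuous $\mathbb{K}$-linear maps $V\to\mathbb{K}$. *)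

theory Defs
  imports "HOL-Analysis.Analysis" "HOL-Algebra.Module"
begin

locale topological_field = field K for K :: "('k, 'm) ring_scheme" (structure) +
  fixes T :: "'k topology"
  assumes topspace_eq: "topspace T = carrier K"
    and continuous_uminus: "continuous_map T T (\<lambda>x. \<ominus> x)"
    and continuous_add: "continuous_map (prod_topology T T) T (\<lambda>(x, y). x \<oplus> y)"
    and continuous_mult: "continuous_map (prod_topology T T) T (\<lambda>(x, y). x \<otimes> y)"
    and continuous_inverse: "continuous_map (subtopology T (carrier K - {\<zero>})) T (\<lambda>x. inv x)"

text \<open>
  The record type of modules extends that of rings; the ring multiplication and its unit play
  no role in the locale of modules and are left unspecified below.

  Maps defined on a set are represented by extensional functions, so that two maps are equal
  iff they agree on that set. This also covers the empty set.
\<close>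

definition fun_module :: "('k, 'm) ring_scheme \<Rightarrow> 'x set \<Rightarrow> ('k, 'x \<Rightarrow> 'k) module" where
  "fun_module K X =
    \<lparr>carrier = X \<rightarrow>\<^sub>E carrier K,
     monoid.mult = undefined,
     one = undefined,
     zero = (\<lambda>x\<in>X. \<zero>\<^bsub>K\<^esub>),
     add = (\<lambda>f g. \<lambda>x\<in>X. f x \<oplus>\<^bsub>K\<^esub> g x),
     smult = (\<lambda>a f. \<lambda>x\<in>X. a \<otimes>\<^bsub>K\<^esub> f x)\<rparr>"

definition finsupp_module :: "('k, 'm) ring_scheme \<Rightarrow> 'x set \<Rightarrow> ('k, 'x \<Rightarrow> 'k) module" where
  "finsupp_module K X =
    (fun_module K X)\<lparr>carrier := {f \<in> X \<rightarrow>\<^sub>E carrier K. finite {x \<in> X. f x \<noteq> \<zero>\<^bsub>K\<^esub>}}\<rparr>"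

definition scalar_module :: "('k, 'm) ring_scheme \<Rightarrow> ('k, 'k) module" where
  "scalar_module K =
    \<lparr>carrier = carrier K, monoid.mult = undefined, one = undefined,
     zero = \<zero>\<^bsub>K\<^esub>, add = (\<oplus>\<^bsub>K\<^esub>), smult = (\<otimes>\<^bsub>K\<^esub>)\<rparr>"

definition linear_maps ::
  "('k, 'm) ring_scheme \<Rightarrow> ('k, 'v, 'n) module_scheme \<Rightarrow> ('k, 'w, 'p) module_scheme
    \<Rightarrow> ('v \<Rightarrow> 'w) set" where
  "linear_maps K V W =
    {h \<in> carrier V \<rightarrow>\<^sub>E carrier W.
      (\<forall>u\<in>carrier V. \<forall>v\<in>carrier V. h (u \<oplus>\<^bsub>V\<^esub> v) = h u \<oplus>\<^bsub>W\<^esub> h v) \<and>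
      (\<forall>a\<in>carrier K. \<forall>v\<in>carrier V. h (a \<odot>\<^bsub>V\<^esub> v) = a \<odot>\<^bsub>W\<^esub> h v)}"

definition topological_dual ::
  "('k, 'm) ring_scheme \<Rightarrow> 'k topology \<Rightarrow> ('k, 'v, 'n) module_scheme \<Rightarrow> 'v topology
    \<Rightarrow> ('k, 'v \<Rightarrow> 'k) module" where
  "topological_dual K T V TV =
    (fun_module K (carrier V))
      \<lparr>carrier := {\<phi> \<in> linear_maps K V (scalar_module K). continuous_map TV T \<phi>}\<rparr>"

text \<open>
  Over a field, this is isomorphism of vector spaces. The name of the module locale is
  qualified because the type-class based library has a locale with the same base name.
\<close>

definition isomorphic_modules ::
  "('k, 'm) ring_scheme \<Rightarrow> ('k, 'v, 'n) module_scheme \<Rightarrow> ('k, 'w, 'p) module_scheme \<Rightarrow> bool" where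
  "isomorphic_modules K V W \<longleftrightarrow>
    Module.module K V \<and> Module.module K W \<and>
    (\<exists>h\<in>linear_maps K V W. bij_betw h (carrier V) (carrier W))"

end

theory Submission
  imports Defs
begin

text \<open>
  A functional on \<open>K\<^sup>X\<close> is tested on the unit vectors \<open>unit_fun K X x\<close>, and the isomorphism is
  \<open>\<phi> \<mapsto> (\<lambda>x. \<phi> (unit_fun K X x))\<close>. The point is that a continuous \<open>\<phi>\<close> only sees finitely many
  coordinates. Choose a neighbourhood \<open>U\<close> of \<open>\<zero>\<close> that omits \<open>\<one>\<close>. By continuity at the zero map,
  \<open>\<phi>\<close> sends some basic neighbourhood of it into \<open>U\<close>; this neighbourhood constrains only the
  coordinates in a finite set \<open>F\<close>, so it contains the whole subspace of maps that vanish on \<open>F\<close>. The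
  image of this subspace is a linear subspace of \<open>K\<close> inside \<open>U\<close>, and a nonzero subspace of a
  field contains \<open>\<one>\<close>; so the image is zero. This is
  \<open>continuous_functional_vanishes_off_finite\<close>, the only place where separation is needed.

  Consequently \<open>\<phi>\<close> kills the unit vectors outside \<open>F\<close>, and since every map is the sum of a map
  supported in \<open>F\<close> and a map vanishing on \<open>F\<close>, it is given by
  \<open>\<phi> f = (\<Oplus>x\<in>F. \<phi> (unit_fun K X x) \<otimes> f x)\<close> (\<open>linear_functional_eq_finsum\<close>). So the family
  of coordinates is finitely supported and determines \<open>\<phi>\<close>. Conversely, a finitely supported family
  \<open>g\<close> is the family of coordinates of \<open>f \<mapsto> (\<Oplus>x. g x \<otimes> f x)\<close>, which is continuous as a finite sum of
  multiples of projections (\<open>coordinate_pairing_continuous\<close>).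
\<close>

section \<open>The modules involved\<close>

lemma fun_module_simps:
  "carrier (fun_module K X) = X \<rightarrow>\<^sub>E carrier K"
  "zero (fun_module K X) = (\<lambda>x\<in>X. \<zero>\<^bsub>K\<^esub>)"
  "add (fun_module K X) f g = (\<lambda>x\<in>X. f x \<oplus>\<^bsub>K\<^esub> g x)"
  "smult (fun_module K X) a f = (\<lambda>x\<in>X. a \<otimes>\<^bsub>K\<^esub> f x)"
  by (simp_all add: fun_module_def)

lemma (in cring) fun_module_is_module: "Module.module R (fun_module R X)"
proof (rule moduleI)
  show "abelian_group (fun_module R X)"
  proof (rule abelian_groupI)
    fix f assume "f \<in> carrier (fun_module R X)"
    then show "\<exists>g\<in>carrier (fun_module R X). g \<oplus>\<^bsub>fun_module R X\<^esub> f = \<zero>\<^bsub>fun_module R X\<^esub>"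
      by (intro bexI[where x = "\<lambda>x\<in>X. \<ominus> f x"])
        (auto simp: fun_module_simps PiE_iff l_neg intro!: restrict_ext)
  qed (auto simp: fun_module_simps PiE_iff a_ac extensional_def fun_eq_iff)
qed (auto simp: fun_module_simps PiE_iff l_distr r_distr m_assoc extensional_def fun_eq_iff
    intro: cring_axioms)

text \<open>
  Closure under negation comes for free, since negation is multiplication by \<open>\<ominus> \<one>\<close>.
\<close>

lemma (in Module.module) submodule_if_closed:
  assumes "H \<subseteq> carrier M" and "\<zero>\<^bsub>M\<^esub> \<in> H"
    and "\<And>u v. u \<in> H \<Longrightarrow> v \<in> H \<Longrightarrow> u \<oplus>\<^bsub>M\<^esub> v \<in> H"
    and smult: "\<And>a v. a \<in> carrier R \<Longrightarrow> v \<in> H \<Longrightarrow> a \<odot>\<^bsub>M\<^esub> v \<in> H"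
  shows "submodule H R M"
proof (rule submoduleI)
  fix v assume "v \<in> H"
  then have "\<ominus>\<^bsub>M\<^esub> v = (\<ominus> \<one>) \<odot>\<^bsub>M\<^esub> v"
    using assms(1) by (simp add: smult_l_minus subset_iff)
  with \<open>v \<in> H\<close> show "\<ominus>\<^bsub>M\<^esub> v \<in> H"
    by (simp add: smult)
qed (use assms in auto)

lemma (in cring) finsupp_module_is_module: "Module.module R (finsupp_module R X)"
proof -
  interpret M: Module.module R "fun_module R X"
    by (rule fun_module_is_module)
  let ?H = "{f \<in> X \<rightarrow>\<^sub>E carrier R. finite {x \<in> X. f x \<noteq> \<zero>}}"
  have "submodule ?H R (fun_module R X)"
  proof (rule M.submodule_if_closed)
    fix f g assume fg: "f \<in> ?H" "g \<in> ?H"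
    then have "finite ({x \<in> X. f x \<noteq> \<zero>} \<union> {x \<in> X. g x \<noteq> \<zero>})"
      by simp
    then have "finite {x \<in> X. f x \<oplus> g x \<noteq> \<zero>}"
      by (rule rev_finite_subset) auto
    with fg show "f \<oplus>\<^bsub>fun_module R X\<^esub> g \<in> ?H"
      by (auto simp: fun_module_simps PiE_iff cong: conj_cong)
  next
    fix a f assume af: "a \<in> carrier R" "f \<in> ?H"
    then have "finite {x \<in> X. f x \<noteq> \<zero>}"
      by simp
    then have "finite {x \<in> X. a \<otimes> f x \<noteq> \<zero>}"
      by (rule rev_finite_subset) (use af in auto)
    with af show "a \<odot>\<^bsub>fun_module R X\<^esub> f \<in> ?H"
      by (auto simp: fun_module_simps PiE_iff cong: conj_cong)
  qed (auto simp: fun_module_simps cong: conj_cong)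
  then show ?thesis
    unfolding finsupp_module_def by (rule submodule.submodule_is_module) (rule M.module_axioms)
qed

context topological_field
begin

lemma continuous_map_add_pointwise:
  assumes "continuous_map Z T f" and "continuous_map Z T g"
  shows "continuous_map Z T (\<lambda>z. f z \<oplus> g z)"
  using continuous_map_compose[OF continuous_map_pairedI[OF assms] continuous_add]
  by (simp add: o_def)

lemma continuous_map_mult_pointwise:
  assumes "continuous_map Z T f" and "continuous_map Z T g"
  shows "continuous_map Z T (\<lambda>z. f z \<otimes> g z)"
  using continuous_map_compose[OF continuous_map_pairedI[OF assms] continuous_mult]
  by (simp add: o_def)

lemma continuous_map_finsum:
  assumes "finite F" and "\<And>x. x \<in> F \<Longrightarrow> continuous_map Z T (f x)"
  shows "continuous_map Z T (\<lambda>z. \<Oplus>x\<in>F. f x z)"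
  using assms
proof (induction F)
  case empty
  then show ?case by (simp add: topspace_eq)
next
  case (insert y F)
  have closed: "f x z \<in> carrier K" if "x \<in> insert y F" "z \<in> topspace Z" for x z
    using insert.prems[OF that(1)] that(2) topspace_eq by (auto simp: continuous_map_def)
  have "continuous_map Z T (\<lambda>z. f y z \<oplus> (\<Oplus>x\<in>F. f x z))"
    using insert by (intro continuous_map_add_pointwise) auto
  then show ?case
    by (rule continuous_map_eq) (use insert.hyps closed in \<open>simp add: Pi_def\<close>)
qed

text \<open>
  The dual of \<open>V\<close> sits inside the module of all maps from the carrier of \<open>V\<close> to the field, so only
  the closure properties of a submodule remain; continuity of addition and multiplication gives them.
\<close>

lemma topological_dual_is_module:
  assumes "Module.module K V" and top: "topspace TV = carrier V"
  shows "Module.module K (topological_dual K T V TV)"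
proof -
  interpret V: Module.module K V by fact
  interpret M: Module.module K "fun_module K (carrier V)"
    by (rule fun_module_is_module)
  let ?H = "{\<phi> \<in> linear_maps K V (scalar_module K). continuous_map TV T \<phi>}"
  have "submodule ?H K (fun_module K (carrier V))"
  proof (rule M.submodule_if_closed)
    show "?H \<subseteq> carrier (fun_module K (carrier V))"
      by (auto simp: linear_maps_def fun_module_simps scalar_module_def)
    have "continuous_map TV T (\<lambda>v\<in>carrier V. \<zero>)"
      by (rule continuous_map_eq[where f = "\<lambda>_. \<zero>"]) (auto simp: top topspace_eq)
    then show "\<zero>\<^bsub>fun_module K (carrier V)\<^esub> \<in> ?H"
      by (auto simp: linear_maps_def fun_module_simps scalar_module_def)
  next
    fix \<phi> \<psi> assume H: "\<phi> \<in> ?H" "\<psi> \<in> ?H"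
    then have "continuous_map TV T (\<lambda>v. \<phi> v \<oplus> \<psi> v)"
      by (intro continuous_map_add_pointwise) auto
    then have "continuous_map TV T (\<lambda>v\<in>carrier V. \<phi> v \<oplus> \<psi> v)"
      by (rule continuous_map_eq) (auto simp: top)
    with H show "\<phi> \<oplus>\<^bsub>fun_module K (carrier V)\<^esub> \<psi> \<in> ?H"
      by (auto simp: linear_maps_def fun_module_simps scalar_module_def PiE_iff a_ac r_distr)
  next
    fix a \<phi> assume a: "a \<in> carrier K" and H: "\<phi> \<in> ?H"
    then have "continuous_map TV T (\<lambda>v. a \<otimes> \<phi> v)"
      by (intro continuous_map_mult_pointwise) (auto simp: topspace_eq)
    then have "continuous_map TV T (\<lambda>v\<in>carrier V. a \<otimes> \<phi> v)"
      by (rule continuous_map_eq) (auto simp: top)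
    with a H show "a \<odot>\<^bsub>fun_module K (carrier V)\<^esub> \<phi> \<in> ?H"
      by (auto simp: linear_maps_def fun_module_simps scalar_module_def PiE_iff r_distr m_lcomm)
  qed
  then show ?thesis
    unfolding topological_dual_def by (rule submodule.submodule_is_module) (rule M.module_axioms)
qed

end


section \<open>Coordinates of functionals\<close>

definition unit_fun :: "('k, 'm) ring_scheme \<Rightarrow> 'x set \<Rightarrow> 'x \<Rightarrow> 'x \<Rightarrow> 'k" where
  "unit_fun K X x = (\<lambda>y\<in>X. if y = x then \<one>\<^bsub>K\<^esub> else \<zero>\<^bsub>K\<^esub>)"

definition cut_off :: "('k, 'm) ring_scheme \<Rightarrow> 'x set \<Rightarrow> 'x set \<Rightarrow> ('x \<Rightarrow> 'k) \<Rightarrow> 'x \<Rightarrow> 'k" where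
  "cut_off K X F f = (\<lambda>y\<in>X. if y \<in> F then f y else \<zero>\<^bsub>K\<^esub>)"

text \<open>
  Summing over the support of \<open>g\<close> makes this the formal sum \<open>\<Oplus>x\<in>X. g x \<otimes> f x\<close> for finitely supported
  \<open>g\<close>. If the support is infinite, \<open>finsum\<close> returns zero and the pairing is the zero functional.
\<close>

definition coordinate_pairing ::
  "('k, 'm) ring_scheme \<Rightarrow> 'x set \<Rightarrow> ('x \<Rightarrow> 'k) \<Rightarrow> ('x \<Rightarrow> 'k) \<Rightarrow> 'k" where
  "coordinate_pairing K X g =
    (\<lambda>f\<in>X \<rightarrow>\<^sub>E carrier K. \<Oplus>\<^bsub>K\<^esub>x\<in>{x \<in> X. g x \<noteq> \<zero>\<^bsub>K\<^esub>}. g x \<otimes>\<^bsub>K\<^esub> f x)"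

lemma linear_functional_on_fun_moduleD:
  assumes "\<phi> \<in> linear_maps K (fun_module K X) (scalar_module K)"
  shows "\<And>f. f \<in> X \<rightarrow>\<^sub>E carrier K \<Longrightarrow> \<phi> f \<in> carrier K"
    and "\<And>f g. f \<in> X \<rightarrow>\<^sub>E carrier K \<Longrightarrow> g \<in> X \<rightarrow>\<^sub>E carrier K
      \<Longrightarrow> \<phi> (\<lambda>x\<in>X. f x \<oplus>\<^bsub>K\<^esub> g x) = \<phi> f \<oplus>\<^bsub>K\<^esub> \<phi> g"
    and "\<And>a f. a \<in> carrier K \<Longrightarrow> f \<in> X \<rightarrow>\<^sub>E carrier K
      \<Longrightarrow> \<phi> (\<lambda>x\<in>X. a \<otimes>\<^bsub>K\<^esub> f x) = a \<otimes>\<^bsub>K\<^esub> \<phi> f"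
    and "\<phi> \<in> extensional (X \<rightarrow>\<^sub>E carrier K)"
  using assms by (auto simp: linear_maps_def fun_module_simps scalar_module_def PiE_iff)

context cring
begin

lemma unit_fun_closed: "unit_fun R X x \<in> X \<rightarrow>\<^sub>E carrier R"
  by (auto simp: unit_fun_def)

lemma cut_off_closed: "f \<in> X \<rightarrow>\<^sub>E carrier R \<Longrightarrow> cut_off R X F f \<in> X \<rightarrow>\<^sub>E carrier R"
  by (auto simp: cut_off_def PiE_iff)

text \<open>
  The cut-off is the finite linear combination of unit vectors with coefficients \<open>f x\<close>. Induction
  on \<open>F\<close> adds one of these multiples at a time, so linearity for two summands is enough.
\<close>

lemma linear_functional_cut_off:
  assumes \<phi>: "\<phi> \<in> linear_maps R (fun_module R X) (scalar_module R)"
    and f: "f \<in> X \<rightarrow>\<^sub>E carrier R"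
    and "finite F" and "F \<subseteq> X"
  shows "\<phi> (cut_off R X F f) = (\<Oplus>x\<in>F. \<phi> (unit_fun R X x) \<otimes> f x)"
  using assms(3,4)
proof (induction F)
  case empty
  have "cut_off R X {} f = (\<lambda>y\<in>X. \<zero> \<otimes> cut_off R X {} f y)"
    by (auto simp: cut_off_def fun_eq_iff)
  then have "\<phi> (cut_off R X {} f) = \<zero> \<otimes> \<phi> (cut_off R X {} f)"
    using linear_functional_on_fun_moduleD(3)[OF \<phi> zero_closed cut_off_closed[OF f]] by metis
  then show ?case
    using linear_functional_on_fun_moduleD(1)[OF \<phi> cut_off_closed[OF f]] by simp
next
  case (insert x F)
  let ?e = "\<lambda>y. unit_fun R X y"
  have fx: "f y \<in> carrier R" if "y \<in> insert x F" for y
    using f insert.prems that by auto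
  have \<phi>e: "\<phi> (?e y) \<in> carrier R" for y
    by (rule linear_functional_on_fun_moduleD(1)[OF \<phi> unit_fun_closed])
  let ?fe = "\<lambda>y\<in>X. f x \<otimes> ?e x y"
  have fe: "?fe \<in> X \<rightarrow>\<^sub>E carrier R"
    using fx by (auto simp: unit_fun_def)
  have \<phi>fe: "\<phi> ?fe = f x \<otimes> \<phi> (?e x)"
    using fx by (intro linear_functional_on_fun_moduleD(3)[OF \<phi> _ unit_fun_closed]) simp
  have "cut_off R X (insert x F) f = (\<lambda>y\<in>X. ?fe y \<oplus> cut_off R X F f y)"
    using insert.hyps insert.prems f by (auto simp: cut_off_def unit_fun_def fun_eq_iff PiE_iff)
  then have "\<phi> (cut_off R X (insert x F) f) = f x \<otimes> \<phi> (?e x) \<oplus> \<phi> (cut_off R X F f)"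
    using linear_functional_on_fun_moduleD(2)[OF \<phi> fe cut_off_closed[OF f]] \<phi>fe by metis
  also have "\<dots> = (\<Oplus>y\<in>insert x F. \<phi> (?e y) \<otimes> f y)"
    using insert fx \<phi>e by (simp add: m_comm Pi_def)
  finally show ?case .
qed

text \<open>
  The map \<open>f\<close> splits into its parts on and off \<open>F\<close>; the second part is killed by \<open>\<phi>\<close>.
\<close>

lemma linear_functional_eq_finsum:
  assumes \<phi>: "\<phi> \<in> linear_maps R (fun_module R X) (scalar_module R)"
    and F: "finite F" "F \<subseteq> X"
    and vanish: "\<And>f. f \<in> X \<rightarrow>\<^sub>E carrier R \<Longrightarrow> \<forall>x\<in>F. f x = \<zero> \<Longrightarrow> \<phi> f = \<zero>"
    and f: "f \<in> X \<rightarrow>\<^sub>E carrier R"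
  shows "\<phi> f = (\<Oplus>x\<in>F. \<phi> (unit_fun R X x) \<otimes> f x)"
proof -
  have "f = (\<lambda>y\<in>X. cut_off R X F f y \<oplus> cut_off R X (- F) f y)"
    using f by (auto simp: cut_off_def fun_eq_iff PiE_iff extensional_def)
  then have "\<phi> f = \<phi> (cut_off R X F f) \<oplus> \<phi> (cut_off R X (- F) f)"
    using linear_functional_on_fun_moduleD(2)[OF \<phi> cut_off_closed[OF f] cut_off_closed[OF f]]
    by metis
  moreover have "\<phi> (cut_off R X (- F) f) = \<zero>"
    using F(2) by (intro vanish cut_off_closed[OF f]) (auto simp: cut_off_def)
  ultimately have "\<phi> f = \<phi> (cut_off R X F f)"
    using linear_functional_on_fun_moduleD(1)[OF \<phi> cut_off_closed[OF f]] by simp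
  then show ?thesis
    using linear_functional_cut_off[OF \<phi> f F] by simp
qed

lemma coordinate_pairing_linear:
  assumes g: "g \<in> X \<rightarrow>\<^sub>E carrier R"
  shows "coordinate_pairing R X g \<in> linear_maps R (fun_module R X) (scalar_module R)"
proof -
  let ?S = "{x \<in> X. g x \<noteq> \<zero>}"
  define c where "c f = (\<Oplus>x\<in>?S. g x \<otimes> f x)" for f
  have pairing: "coordinate_pairing R X g = restrict c (X \<rightarrow>\<^sub>E carrier R)"
    by (auto simp: coordinate_pairing_def c_def fun_eq_iff)
  have add: "c (\<lambda>x\<in>X. u x \<oplus> v x) = c u \<oplus> c v"
    if "u \<in> X \<rightarrow>\<^sub>E carrier R" "v \<in> X \<rightarrow>\<^sub>E carrier R" for u v
  proof -
    have "c (\<lambda>x\<in>X. u x \<oplus> v x) = (\<Oplus>x\<in>?S. g x \<otimes> u x \<oplus> g x \<otimes> v x)"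
      unfolding c_def using g that by (intro finsum_cong') (auto simp: r_distr PiE_iff)
    also have "\<dots> = c u \<oplus> c v"
      unfolding c_def using g that by (intro finsum_addf) (auto simp: PiE_iff)
    finally show ?thesis .
  qed
  have smult: "c (\<lambda>x\<in>X. a \<otimes> v x) = a \<otimes> c v"
    if "a \<in> carrier R" "v \<in> X \<rightarrow>\<^sub>E carrier R" for a v
  proof -
    have "c (\<lambda>x\<in>X. a \<otimes> v x) = (\<Oplus>x\<in>?S. a \<otimes> (g x \<otimes> v x))"
      unfolding c_def using g that by (intro finsum_cong') (auto simp: m_lcomm PiE_iff)
    also have "\<dots> = a \<otimes> c v"
    proof (cases "finite ?S")
      case True
      then show ?thesis
        unfolding c_def using g that by (intro finsum_rdistr[symmetric]) (auto simp: PiE_iff)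
    next
      case False
      then show ?thesis
        unfolding c_def using that by (simp add: finsum_infinite)
    qed
    finally show ?thesis .
  qed
  have "c v \<in> carrier R" if "v \<in> X \<rightarrow>\<^sub>E carrier R" for v
    unfolding c_def using g that by (intro finsum_closed) (auto simp: PiE_iff)
  moreover have "(\<lambda>x\<in>X. u x \<oplus> v x) \<in> X \<rightarrow>\<^sub>E carrier R"
    if "u \<in> X \<rightarrow>\<^sub>E carrier R" "v \<in> X \<rightarrow>\<^sub>E carrier R" for u v
    using that by (auto simp: PiE_iff)
  moreover have "(\<lambda>x\<in>X. a \<otimes> v x) \<in> X \<rightarrow>\<^sub>E carrier R"
    if "a \<in> carrier R" "v \<in> X \<rightarrow>\<^sub>E carrier R" for a v
    using that by (auto simp: PiE_iff)
  ultimately show ?thesis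
    by (simp add: linear_maps_def pairing fun_module_simps scalar_module_def add smult)
qed

lemma coordinate_pairing_unit_fun:
  assumes g: "g \<in> X \<rightarrow>\<^sub>E carrier R" and fin: "finite {x \<in> X. g x \<noteq> \<zero>}" and x: "x \<in> X"
  shows "coordinate_pairing R X g (unit_fun R X x) = g x"
proof -
  let ?S = "{x \<in> X. g x \<noteq> \<zero>}"
  have "coordinate_pairing R X g (unit_fun R X x) = (\<Oplus>y\<in>?S. g y \<otimes> unit_fun R X x y)"
    by (simp add: coordinate_pairing_def unit_fun_closed)
  also have "\<dots> = (\<Oplus>y\<in>?S. if x = y then g y else \<zero>)"
    using g by (intro finsum_cong') (auto simp: unit_fun_def PiE_iff)
  also have "\<dots> = g x"
  proof (cases "x \<in> ?S")
    case True
    then show ?thesis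
      using g fin by (intro add.finprod_singleton) (auto simp: PiE_iff)
  next
    case False
    then have "(\<Oplus>y\<in>?S. if x = y then g y else \<zero>) = (\<Oplus>y\<in>?S. \<zero>)"
      by (intro finsum_cong') auto
    with False x show ?thesis by simp
  qed
  finally show ?thesis .
qed

end


section \<open>Continuity forces finite support\<close>

context topological_field
begin

lemma coordinate_pairing_continuous:
  assumes g: "g \<in> X \<rightarrow>\<^sub>E carrier K" and fin: "finite {x \<in> X. g x \<noteq> \<zero>}"
  shows "continuous_map (product_topology (\<lambda>_. T) X) T (coordinate_pairing K X g)"
proof (rule continuous_map_eq)
  show "continuous_map (product_topology (\<lambda>_. T) X) T
    (\<lambda>f. \<Oplus>x\<in>{x \<in> X. g x \<noteq> \<zero>}. g x \<otimes> f x)"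
    using g by (intro continuous_map_finsum[OF fin] continuous_map_mult_pointwise
        continuous_map_product_projection) (auto simp: topspace_eq)
qed (simp add: coordinate_pairing_def topspace_eq)

text \<open>
  The maps vanishing on \<open>F\<close> form a subspace inside a neighbourhood whose image avoids \<open>\<one>\<close>. If \<open>\<phi> f\<close>
  were nonzero for such an \<open>f\<close>, rescaling \<open>f\<close> by \<open>inv (\<phi> f)\<close> would produce the value \<open>\<one>\<close>.
\<close>

lemma continuous_functional_vanishes_off_finite:
  assumes \<phi>: "\<phi> \<in> linear_maps K (fun_module K X) (scalar_module K)"
    and cont: "continuous_map (product_topology (\<lambda>_. T) X) T \<phi>"
    and "t1_space T"
  obtains F where "finite F" and "F \<subseteq> X"
    and "\<And>f. f \<in> X \<rightarrow>\<^sub>E carrier K \<Longrightarrow> \<forall>x\<in>F. f x = \<zero> \<Longrightarrow> \<phi> f = \<zero>"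
proof -
  let ?P = "product_topology (\<lambda>_. T) X" and ?o = "\<lambda>x\<in>X. \<zero>"
  note \<phi>D = linear_functional_on_fun_moduleD[OF \<phi>]
  have o: "?o \<in> X \<rightarrow>\<^sub>E carrier K" by simp
  \<comment> \<open>Homogeneity for the scalar \<open>\<zero>\<close> gives the value at the zero map.\<close>
  have "?o = (\<lambda>x\<in>X. \<zero> \<otimes> ?o x)" by (auto simp: fun_eq_iff)
  then have "\<phi> ?o = \<zero> \<otimes> \<phi> ?o"
    using \<phi>D(3)[OF zero_closed o] by metis
  then have \<phi>o: "\<phi> ?o = \<zero>"
    using \<phi>D(1)[OF o] by simp
  obtain U where U: "openin T U" "\<zero> \<in> U" "\<one> \<notin> U"
    using \<open>t1_space T\<close>[unfolded t1_space_def topspace_eq, rule_format,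
        OF zero_closed one_closed zero_not_one] by auto
  have open_preimage: "openin ?P {f \<in> topspace ?P. \<phi> f \<in> U}"
    by (rule openin_continuous_map_preimage[OF cont U(1)])
  have o_in_preimage: "?o \<in> {f \<in> topspace ?P. \<phi> f \<in> U}"
    using U(2) \<phi>o by (simp add: topspace_eq)
  obtain W where W: "?o \<in> (\<Pi>\<^sub>E x\<in>X. W x)"
      "finite {x. W x \<noteq> topspace T}" "(\<Pi>\<^sub>E x\<in>X. W x) \<subseteq> {f \<in> topspace ?P. \<phi> f \<in> U}"
    using product_topology_open_contains_basis[OF open_preimage o_in_preimage] by blast
  show thesis
  proof (rule that)
    \<comment> \<open>The indices whose coordinate the basic neighbourhood constrains.\<close>
    let ?F = "{x \<in> X. W x \<noteq> topspace T}"
    show "finite ?F"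
      by (rule finite_subset[OF _ W(2)]) auto
    fix f assume f: "f \<in> X \<rightarrow>\<^sub>E carrier K" and f0: "\<forall>x\<in>?F. f x = \<zero>"
    have U_line: "a \<otimes> \<phi> f \<in> U" if a: "a \<in> carrier K" for a
    proof -
      have "(\<lambda>x\<in>X. a \<otimes> f x) \<in> (\<Pi>\<^sub>E x\<in>X. W x)"
      proof (rule restrict_PiE[THEN iffD2], rule Pi_I)
        fix x assume x: "x \<in> X"
        show "a \<otimes> f x \<in> W x"
        proof (cases "x \<in> ?F")
          case True
          moreover have "\<zero> \<in> W x"
            using W(1) x by (auto simp: PiE_iff)
          ultimately show ?thesis
            using f0 a by simp
        next
          case False
          then show ?thesis
            using f a x by (auto simp: topspace_eq PiE_iff)
        qed
      qed
      then have "\<phi> (\<lambda>x\<in>X. a \<otimes> f x) \<in> U"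
        using W(3) by blast
      then show ?thesis
        by (simp only: \<phi>D(3)[OF a f])
    qed
    show "\<phi> f = \<zero>"
    proof (rule ccontr)
      assume "\<phi> f \<noteq> \<zero>"
      then have "\<phi> f \<in> Units K"
        using \<phi>D(1)[OF f] by (simp add: field_Units)
      then show False
        using U_line[of "inv (\<phi> f)"] U(3) by simp
    qed
  qed auto
qed

end


section \<open>The dual of a power of the field\<close>

context topological_field
begin

text \<open>
  The isomorphism sends a functional to its family of coordinates \<open>\<lambda>x. \<phi> (unit_fun K X x)\<close>. That this
  family has finite support and determines \<open>\<phi>\<close> both follow from one finite set such that \<open>\<phi>\<close> kills
  every map vanishing on it; the inverse is the pairing with a finitely supported family.
\<close>

theorem topological_dual_fun_module_iso:
  assumes t1: "t1_space T"
  shows "isomorphic_modules K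
    (topological_dual K T (fun_module K X) (product_topology (\<lambda>_. T) X))
    (finsupp_module K X)"
proof -
  let ?P = "product_topology (\<lambda>_. T) X"
  let ?D = "topological_dual K T (fun_module K X) ?P"
  let ?e = "unit_fun K X"
  define h where "h = (\<lambda>\<phi>\<in>carrier ?D. \<lambda>x\<in>X. \<phi> (?e x))"
  have D: "carrier ?D = {\<phi> \<in> linear_maps K (fun_module K X) (scalar_module K). continuous_map ?P T \<phi>}"
    by (simp add: topological_dual_def)
  have S: "carrier (finsupp_module K X) = {f \<in> X \<rightarrow>\<^sub>E carrier K. finite {x \<in> X. f x \<noteq> \<zero>}}"
    by (simp add: finsupp_module_def)
  have D_module: "Module.module K ?D"
    by (intro topological_dual_is_module fun_module_is_module)
      (simp add: fun_module_simps topspace_eq)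
  interpret D: Module.module K ?D by (rule D_module)
  have closed: "\<phi> (?e x) \<in> carrier K" if "\<phi> \<in> carrier ?D" for \<phi> x
    using that linear_functional_on_fun_moduleD(1)[OF _ unit_fun_closed] by (auto simp: D)
  have finite_support: "\<exists>F. finite F \<and> F \<subseteq> X \<and> (\<forall>x\<in>X - F. \<phi> (?e x) = \<zero>)
      \<and> (\<forall>f\<in>X \<rightarrow>\<^sub>E carrier K. \<phi> f = (\<Oplus>x\<in>F. \<phi> (?e x) \<otimes> f x))"
    if "\<phi> \<in> carrier ?D" for \<phi>
  proof -
    have \<phi>: "\<phi> \<in> linear_maps K (fun_module K X) (scalar_module K)" "continuous_map ?P T \<phi>"
      using that by (auto simp: D)
    obtain F where F: "finite F" "F \<subseteq> X"
      "\<And>f. f \<in> X \<rightarrow>\<^sub>E carrier K \<Longrightarrow> \<forall>x\<in>F. f x = \<zero> \<Longrightarrow> \<phi> f = \<zero>"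
      using continuous_functional_vanishes_off_finite[OF \<phi> t1] by metis
    have "\<phi> (?e x) = \<zero>" if "x \<in> X - F" for x
      using F(2) that by (intro F(3) unit_fun_closed) (auto simp: unit_fun_def)
    with F(1,2) linear_functional_eq_finsum[OF \<phi>(1) F] show ?thesis
      by blast
  qed
  have h_closed: "h \<phi> \<in> carrier (finsupp_module K X)" if \<phi>: "\<phi> \<in> carrier ?D" for \<phi>
  proof -
    obtain F where F: "finite F" "\<forall>x\<in>X - F. \<phi> (?e x) = \<zero>"
      using finite_support[OF \<phi>] by blast
    have "finite {x \<in> X. h \<phi> x \<noteq> \<zero>}"
      by (rule finite_subset[OF _ F(1)]) (use F(2) \<phi> in \<open>auto simp: h_def\<close>)
    then show ?thesis
      using \<phi> closed by (auto simp: S h_def)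
  qed
  have h_linear: "h \<in> linear_maps K ?D (finsupp_module K X)"
  proof -
    have "h (\<phi> \<oplus>\<^bsub>?D\<^esub> \<psi>) = h \<phi> \<oplus>\<^bsub>finsupp_module K X\<^esub> h \<psi>"
      if "\<phi> \<in> carrier ?D" "\<psi> \<in> carrier ?D" for \<phi> \<psi>
      using D.a_closed[OF that] that
      by (auto simp: h_def topological_dual_def finsupp_module_def fun_module_simps
          unit_fun_closed fun_eq_iff)
    moreover have "h (a \<odot>\<^bsub>?D\<^esub> \<phi>) = a \<odot>\<^bsub>finsupp_module K X\<^esub> h \<phi>"
      if "a \<in> carrier K" "\<phi> \<in> carrier ?D" for a \<phi>
      using D.smult_closed[OF that] that
      by (auto simp: h_def topological_dual_def finsupp_module_def fun_module_simps
          unit_fun_closed fun_eq_iff)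
    ultimately show ?thesis
      using h_closed by (auto simp: linear_maps_def PiE_iff h_def)
  qed
  have "inj_on h (carrier ?D)"
  proof (rule inj_onI)
    fix \<phi> \<psi> assume \<phi>: "\<phi> \<in> carrier ?D" and \<psi>: "\<psi> \<in> carrier ?D" and eq: "h \<phi> = h \<psi>"
    have coord: "\<phi> (?e x) = \<psi> (?e x)" if "x \<in> X" for x
      using fun_cong[OF eq, of x] \<phi> \<psi> that by (simp add: h_def)
    obtain F where F: "finite F" "F \<subseteq> X" "\<forall>x\<in>X - F. \<phi> (?e x) = \<zero>"
      "\<forall>f\<in>X \<rightarrow>\<^sub>E carrier K. \<phi> f = (\<Oplus>x\<in>F. \<phi> (?e x) \<otimes> f x)"
      using finite_support[OF \<phi>] by blast
    obtain G where G: "finite G" "G \<subseteq> X" "\<forall>x\<in>X - G. \<psi> (?e x) = \<zero>"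
      "\<forall>f\<in>X \<rightarrow>\<^sub>E carrier K. \<psi> f = (\<Oplus>x\<in>G. \<psi> (?e x) \<otimes> f x)"
      using finite_support[OF \<psi>] by blast
    show "\<phi> = \<psi>"
    proof (rule extensionalityI)
      show "\<phi> \<in> extensional (X \<rightarrow>\<^sub>E carrier K)" "\<psi> \<in> extensional (X \<rightarrow>\<^sub>E carrier K)"
        using \<phi> \<psi> linear_functional_on_fun_moduleD(4) by (auto simp: D)
      fix f assume f: "f \<in> X \<rightarrow>\<^sub>E carrier K"
      have fK: "f x \<in> carrier K" if "x \<in> X" for x
        using f that by auto
      \<comment> \<open>The finite sets of \<open>\<phi>\<close> and \<open>\<psi>\<close> may differ, so both sums are extended to the union.\<close>
      have "\<phi> f = (\<Oplus>x\<in>F. \<phi> (?e x) \<otimes> f x)"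
        using F(4) f by blast
      also have "\<dots> = (\<Oplus>x\<in>F \<union> G. \<phi> (?e x) \<otimes> f x)"
        using F G closed[OF \<phi>] fK by (intro add.finprod_mono_neutral_cong_left) auto
      also have "\<dots> = (\<Oplus>x\<in>F \<union> G. \<psi> (?e x) \<otimes> f x)"
        using F G closed[OF \<psi>] fK coord by (intro finsum_cong') auto
      also have "\<dots> = (\<Oplus>x\<in>G. \<psi> (?e x) \<otimes> f x)"
        using F G closed[OF \<psi>] fK by (intro add.finprod_mono_neutral_cong_right) auto
      also have "\<dots> = \<psi> f"
        using G(4) f by simp
      finally show "\<phi> f = \<psi> f" .
    qed
  qed
  moreover have "h ` carrier ?D = carrier (finsupp_module K X)"
  proof
    show "h ` carrier ?D \<subseteq> carrier (finsupp_module K X)"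
      using h_closed by blast
    show "carrier (finsupp_module K X) \<subseteq> h ` carrier ?D"
    proof
      fix g assume "g \<in> carrier (finsupp_module K X)"
      then have g: "g \<in> X \<rightarrow>\<^sub>E carrier K" "finite {x \<in> X. g x \<noteq> \<zero>}"
        by (auto simp: S)
      have mem: "coordinate_pairing K X g \<in> carrier ?D"
        using coordinate_pairing_linear[OF g(1)] coordinate_pairing_continuous[OF g]
        by (simp add: D)
      have "h (coordinate_pairing K X g) = (\<lambda>x\<in>X. g x)"
        unfolding h_def using mem coordinate_pairing_unit_fun[OF g] by (auto simp: fun_eq_iff)
      also have "\<dots> = g"
        using g(1) by (simp add: PiE_restrict)
      finally show "g \<in> h ` carrier ?D"
        using mem by force
    qed
  qed
  ultimately show ?thesis
    unfolding isomorphic_modules_def bij_betw_def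
    using D_module finsupp_module_is_module h_linear by blast
qed

end

theorem theorem5:
  fixes K :: "('k, 'm) ring_scheme" and T :: "'k topology" and X :: "'x set"
  assumes "topological_field K T" and "Hausdorff_space T"
  shows "isomorphic_modules K
    (topological_dual K T (fun_module K X) (product_topology (\<lambda>_. T) X))
    (finsupp_module K X)"
  using assms(1) Hausdorff_imp_t1_space[OF assms(2)]
  by (rule topological_field.topological_dual_fun_module_iso)

end
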